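(* Let $t\le T-1$ and let $\xi\in L^0(\mathbb R^d,\mathcal F_T)$ be hedgeable. Suppose that there exists an $\mathcal F_{t+1}$-normal integrand $\tilde\gamma_{t+1}^{\xi}$ on $\Omega\times\mathbb R^d$ such that $\gamma_{t+1}^{\xi}(V_t)=\tilde\gamma_{t+1}^{\xi}(V_t)$ for all $V_t\in L^0(\mathbb R^d,\mathcal F_t)$. Assume that for any $u\le T$, $|C_u((0,x^{(2)}))|<\bar h_u(x)$, where $\bar h_u:\Omega\times\mathbb R^d\to\mathbb R$ is an $\mathcal F_u\otimes\mathcal B(\mathbb R^d)$-measurable random function that is a.s. continuous in $x$. Suppose that the cost function $C_t(z)$ is an $\mathcal F_t$-normal integrand and that $C_t$ is sub-additive and positively super $\delta$-homogeneous. If LAIP holds, then $\gamma_t^{\xi}(V_{t-1})=\tilde\gamma_t^{\xi}(V_{t-1})$ for all $V_{t-1}\in L^0(\mathbb R^d,\mathcal F_t)$, where $\tilde\gamma_t^{\xi}(v_{t-1})$ is an $\mathcal F_t$-normal integrand on $\Omega\times\mathbb R^d$.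
   Context: Setting. $(\Omega,(\mathcal F_t)_{t=0}^T,P)$ is a discrete-time stochastic basis with complete filtration ($\mathcal F_0$ contains the $P$-null sets); $\mathcal F_{-1}:=\mathcal F_0$. For a (random) set $A\subseteq\mathbb R^k$, $L^0(A,\mathcal F_t)$ is the set of (classes of) $\mathcal F_t$-measurable random variables $X$ with $X\in A$ a.s. Equalities between random variables are a.s. For $z\in\mathbb R^d$ write $z=(z^1,z^{(2)})$ with $z^{(2)}=(z^2,\dots,z^d)$, and $e_1=(1,0,\dots,0)$. For a family of random variables, $\operatorname{ess\,sup}_{\mathcal F_t}$ (resp. $\operatorname{ess\,inf}_{\mathcal F_t}$) is the smallest (resp. largest) $\mathcal F_t$-measurable $[-\infty,\infty]$-valued random variable which a.s. dominates (resp. is a.s. dominated by) every member; for a single random variable $X$ it is that of $\{X\}$. An $\mathcal F$-normal integrand is an (extended real-valued) function $f(\omega,x)$ on $\Omega\times\mathbb R^k$ that is $\mathcal F\otimes\mathcal B(\mathbb R^k)$-measurable and lower semicontinuous in $x$; $f(Z)$ denotes $\omega\mapsto f(\omega,Z(\omega))$. Market. $S_t$ is an $\mathcal F_t$-measurable $\mathbb R^m_+$-valued random variable ($m\ge d\ge 1$). For $t\le T$ the cost function $C_t:\mathbb R^m\times\mathbb R^d\to\mathbb R$ is Borel and lower semicontinuous and satisfies: $C_t(s,0)=0$ for $s\in\mathbb R^m_+$; $C_t(s,x+\lambda e_1)=C_t(s,x)+\lambda$ for $\lambda\in\mathbb R$; $C_T(s,x_2)\ge C_T(s,x_1)$ whenever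 $x_2-x_1\in\mathbb R^d_+$; $|C_t(s,x)|\le h_t(s,x)$ for a deterministic continuous function $h_t$. One writes $C_t(x)=C_t(S_t,x)$, and $C_t(0,x^{(2)})$ means $C_t(S_t,(0,x^{(2)}))$. The solvency sets are $G_t=\{z\in\mathbb R^d: -C_t(-z)\ge 0\}$; they are closed, graph-measurable w.r.t. $\mathcal F_t$, satisfy $G_t+\mathbb R^d_+\subseteq G_t$, $-e_1\notin G_t$, and $C_t(z)=\min\{\alpha\in\mathbb R:\alpha e_1-z\in G_t\}$. A portfolio process is an adapted $\mathbb R^d$-valued process $V$ with $V_{-1}\in\mathbb R e_1$ and $V_t-V_{t-1}\in -G_t$ a.s. for $t=0,\dots,T$. The payoff $\xi$ is hedgeable if there is a portfolio process $V^\xi$ with $V_T^\xi=\xi$. $C_t$ is sub-additive if $C_t(x+y)\le C_t(x)+C_t(y)$ for all $x,y\in\mathbb R^d$. Super $\delta$-homogeneity: $\delta$ is an increasing bijection of $[0,+\infty]$ with $\delta(0)=0$, $\delta(\infty)=\infty$, and $C_t$ is positively super $\delta$-homogeneous if $C_t(s,\lambda x)\ge\delta(\lambda)C_t(s,x)$ for all $\lambda\ge1$, $s\in\mathbb R^m_+$, $x\in\mathbb R^d$. Hedging costs. For $\xi\in L^0(\mathbb R^d,\mathcal F_T)$, $0\le t\le T$ and $V_{t-1}\in L^0(\mathbb R^d,\mathcal F_t)$, $$\gamma_t^{\xi}(V_{t-1}):=\operatorname*{ess\,inf}_{V^{(2)}\in\Pi_t^T(V_{t-1},\xi)}{}_{\mathcal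 F_t}\ \operatorname{ess\,sup}_{\mathcal F_t}\Big(\xi^1+\sum_{s=t}^T C_s\big(0,V_s^{(2)}-V_{s-1}^{(2)}\big)\Big),$$ where $\Pi_t^T(V_{t-1},\xi)$ is the set of families $(V_s^{(2)})_{s=t-1}^T$ whose entry at $t-1$ is the given $V_{t-1}^{(2)}$, with $V_s^{(2)}\in L^0(\mathbb R^{d-1},\mathcal F_s)$ for $s=t,\dots,T-1$ and $V_T^{(2)}=\xi^{(2)}$. For $t\le T-1$, $\theta_t^\xi(V_t):=\operatorname{ess\,sup}_{\mathcal F_t}\gamma_{t+1}^\xi(V_t)$ and $D_t^\xi(V_{t-1},V_t):=C_t((0,V_t^{(2)}-V_{t-1}^{(2)}))+\theta_t^\xi(V_t)$. Superscript $0$ means payoff $\xi=0$. The paper supposes that $D_t^0(y,z)$ is (a version which is) $\mathcal F_t\otimes\mathcal B(\mathbb R^d)\otimes\mathcal B(\mathbb R^d)$-measurable in $(\omega,y,z)$ and lower semicontinuous in $(y,z)$. AIP holds at time $t$ if $\gamma_t^0(0)=0$. LAIP holds at time $t$ if AIP holds at time $t$ and $\mathcal N_t:=\{Z_t\in L^0(\mathbb R^d,\mathcal F_t): Z_t^1=0,\ D_t^0(0,Z_t)=0\}$ is a linear vector space, equivalently $\mathcal N_t=L^0(\mathrm N_t,\mathcal F_t)$ where $\mathrm N_t$ is an $\mathcal F_t$-measurable random set which is a.s. a linear subspace of $\mathbb R^d$. LAIP holds if it holds at every time; requirements on $D_t^0$ concern $t\le T-1$. *)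

theory Defs
  imports "HOL-Probability.Probability"
begin

definition lsc :: "('b::topological_space \<Rightarrow> ereal) \<Rightarrow> bool" where
  "lsc f \<longleftrightarrow> (\<forall>x. f x \<le> Liminf (at x) f)"

definition normal_integrand ::
    "'a measure \<Rightarrow> ('a \<Rightarrow> 'b::topological_space \<Rightarrow> ereal) \<Rightarrow> bool" where
  "normal_integrand N f \<longleftrightarrow>
     (\<lambda>(\<omega>, x). f \<omega> x) \<in> borel_measurable (N \<Otimes>\<^sub>M borel) \<and> (\<forall>\<omega>\<in>space N. lsc (f \<omega>))"

text \<open>
  Conditional essential supremum and infimum of a family \<open>\<X>\<close> of random variables on \<open>M\<close> with
  respect to a sub-sigma-algebra \<open>N\<close>.  They are unique only up to almost sure equality, and
  \<open>SOME\<close> picks a version; on a probability space a version always exists.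
\<close>

definition is_ess_sup ::
    "'a measure \<Rightarrow> 'a measure \<Rightarrow> ('a \<Rightarrow> ereal) set \<Rightarrow> ('a \<Rightarrow> ereal) \<Rightarrow> bool" where
  "is_ess_sup M N \<X> Y \<longleftrightarrow>
     Y \<in> borel_measurable N \<and> (\<forall>X\<in>\<X>. AE \<omega> in M. X \<omega> \<le> Y \<omega>) \<and>
     (\<forall>Y'\<in>borel_measurable N. (\<forall>X\<in>\<X>. AE \<omega> in M. X \<omega> \<le> Y' \<omega>) \<longrightarrow> (AE \<omega> in M. Y \<omega> \<le> Y' \<omega>))"

definition is_ess_inf ::
    "'a measure \<Rightarrow> 'a measure \<Rightarrow> ('a \<Rightarrow> ereal) set \<Rightarrow> ('a \<Rightarrow> ereal) \<Rightarrow> bool" where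
  "is_ess_inf M N \<X> Y \<longleftrightarrow>
     Y \<in> borel_measurable N \<and> (\<forall>X\<in>\<X>. AE \<omega> in M. Y \<omega> \<le> X \<omega>) \<and>
     (\<forall>Y'\<in>borel_measurable N. (\<forall>X\<in>\<X>. AE \<omega> in M. Y' \<omega> \<le> X \<omega>) \<longrightarrow> (AE \<omega> in M. Y' \<omega> \<le> Y \<omega>))"

definition ess_sup :: "'a measure \<Rightarrow> 'a measure \<Rightarrow> ('a \<Rightarrow> ereal) set \<Rightarrow> 'a \<Rightarrow> ereal" where
  "ess_sup M N \<X> = (SOME Y. is_ess_sup M N \<X> Y)"

definition ess_inf :: "'a measure \<Rightarrow> 'a measure \<Rightarrow> ('a \<Rightarrow> ereal) set \<Rightarrow> 'a \<Rightarrow> ereal" where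
  "ess_inf M N \<X> = (SOME Y. is_ess_inf M N \<X> Y)"

text \<open>
  \<open>prev t v V s\<close> is the position held just before time \<open>s\<close> by a process started at time \<open>t\<close>
  from \<open>v\<close>: the process is \<open>v, V t, V (t + 1), \<dots>\<close>, with \<open>v\<close> at time \<open>t - 1\<close>.  This provides
  time \<open>-1\<close> (for \<open>t = 0\<close>) although times are natural numbers.
\<close>

definition prev :: "nat \<Rightarrow> 'x \<Rightarrow> (nat \<Rightarrow> 'x) \<Rightarrow> nat \<Rightarrow> 'x" where
  "prev t v V s = (if s = t then v else V (s - 1))"

text \<open>
  The index \<open>cash\<close> is the distinguished first coordinate, so \<open>axis cash 1\<close> is the vector
  \<open>(1, 0, \<dots>, 0)\<close>.  The order on \<open>real ^ 'm\<close> and \<open>real ^ 'd\<close> is componentwise.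
  Assumption \<open>solvency_mono\<close> says that \<open>G\<^sub>t + \<real>\<^sub>+\<^sup>d \<subseteq> G\<^sub>t\<close> for the solvency set \<open>G\<^sub>t\<close> defined
  below; the other properties of \<open>G\<^sub>t\<close> follow from the assumptions on \<open>C\<close>.
\<close>

locale market = prob_space M + complete_measure M
  for M :: "'a measure" +
  fixes F :: "nat \<Rightarrow> 'a measure"
    and T :: nat
    and S :: "nat \<Rightarrow> 'a \<Rightarrow> real ^ 'm"
    and C :: "nat \<Rightarrow> real ^ 'm \<Rightarrow> real ^ 'd \<Rightarrow> real"
    and cash :: 'd
  assumes subalgebra_F: "t \<le> T \<Longrightarrow> subalgebra M (F t)"
    and mono_F: "u \<le> t \<Longrightarrow> t \<le> T \<Longrightarrow> sets (F u) \<subseteq> sets (F t)"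
    and null_F: "null_sets M \<subseteq> sets (F 0)"
    and dim_le: "CARD('d) \<le> CARD('m)"
    and S_measurable: "t \<le> T \<Longrightarrow> S t \<in> borel_measurable (F t)"
    and S_nonneg: "t \<le> T \<Longrightarrow> \<omega> \<in> space M \<Longrightarrow> 0 \<le> S t \<omega>"
    and C_borel: "t \<le> T \<Longrightarrow> (\<lambda>(s, x). C t s x) \<in> borel_measurable borel"
    and C_lsc: "t \<le> T \<Longrightarrow> lsc (\<lambda>(s, x). ereal (C t s x))"
    and C_zero: "t \<le> T \<Longrightarrow> 0 \<le> s \<Longrightarrow> C t s 0 = 0"
    and C_cash: "t \<le> T \<Longrightarrow> 0 \<le> s \<Longrightarrow> C t s (x + l *\<^sub>R axis cash 1) = C t s x + l"
    and C_mono: "0 \<le> s \<Longrightarrow> 0 \<le> x2 - x1 \<Longrightarrow> C T s x1 \<le> C T s x2"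
    and C_bound: "t \<le> T \<Longrightarrow>
          \<exists>h. continuous_on UNIV (\<lambda>(s, x). h s x) \<and> (\<forall>s\<ge>0. \<forall>x. \<bar>C t s x\<bar> \<le> h s x)"
    and solvency_mono: "t \<le> T \<Longrightarrow>
          AE \<omega> in M. \<forall>z r. - C t (S t \<omega>) (- z) \<ge> 0 \<longrightarrow> 0 \<le> r \<longrightarrow> - C t (S t \<omega>) (- (z + r)) \<ge> 0"
begin

definition G :: "nat \<Rightarrow> 'a \<Rightarrow> (real ^ 'd) set" where
  "G t \<omega> = {z. - C t (S t \<omega>) (- z) \<ge> 0}"

lemma minus_cash_notin_G:
  assumes "t \<le> T" "\<omega> \<in> space M"
  shows "- axis cash 1 \<notin> G t \<omega>"
  using C_cash[OF assms(1) S_nonneg[OF assms], of 0 1] C_zero[OF assms(1) S_nonneg[OF assms]]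
  by (simp add: G_def)

lemma cost_is_min:
  assumes "t \<le> T" "\<omega> \<in> space M"
  shows "{a. a *\<^sub>R axis cash 1 - z \<in> G t \<omega>} = {C t (S t \<omega>) z ..}"
proof -
  have "C t (S t \<omega>) (z - a *\<^sub>R axis cash 1) = C t (S t \<omega>) z - a" for a
    using C_cash[OF assms(1) S_nonneg[OF assms], of z "- a"] by simp
  then show ?thesis by (auto simp: G_def)
qed

text \<open>
  \<open>risky z\<close> is \<open>(0, z\<^sup>2, \<dots>, z\<^sup>d)\<close>.  Elements of \<open>\<real>\<close> to the power \<open>d - 1\<close> are represented throughout by
  vectors of \<open>real ^ 'd\<close> whose \<open>cash\<close> component is zero.
\<close>

definition risky :: "real ^ 'd \<Rightarrow> real ^ 'd" where
  "risky z = (\<chi> i. if i = cash then 0 else z $ i)"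

definition portfolio_process :: "('a \<Rightarrow> real ^ 'd) \<Rightarrow> (nat \<Rightarrow> 'a \<Rightarrow> real ^ 'd) \<Rightarrow> bool" where
  "portfolio_process v V \<longleftrightarrow>
     v \<in> borel_measurable (F 0) \<and> (AE \<omega> in M. v \<omega> \<in> span {axis cash 1}) \<and>
     (\<forall>t\<le>T. V t \<in> borel_measurable (F t) \<and>
        (AE \<omega> in M. V t \<omega> - prev 0 v V t \<omega> \<in> uminus ` G t \<omega>))"

definition hedgeable :: "('a \<Rightarrow> real ^ 'd) \<Rightarrow> bool" where
  "hedgeable \<xi> \<longleftrightarrow> (\<exists>v V. portfolio_process v V \<and> (AE \<omega> in M. V T \<omega> = \<xi> \<omega>))"

text \<open>
  The entries at times \<open>t, \<dots>, T\<close> of the members of the strategy set; the given entry at time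
  \<open>t - 1\<close> is supplied through \<open>prev\<close> in \<open>terminal_cost\<close>.
\<close>

definition strategies :: "nat \<Rightarrow> ('a \<Rightarrow> real ^ 'd) \<Rightarrow> (nat \<Rightarrow> 'a \<Rightarrow> real ^ 'd) set" where
  "strategies t \<xi> =
     {V. (\<forall>s\<in>{t..<T}. V s \<in> borel_measurable (F s) \<and> (\<forall>\<omega>\<in>space M. V s \<omega> $ cash = 0)) \<and>
         (\<forall>\<omega>\<in>space M. V T \<omega> = risky (\<xi> \<omega>))}"

definition terminal_cost ::
    "nat \<Rightarrow> ('a \<Rightarrow> real ^ 'd) \<Rightarrow> ('a \<Rightarrow> real ^ 'd) \<Rightarrow> (nat \<Rightarrow> 'a \<Rightarrow> real ^ 'd) \<Rightarrow> 'a \<Rightarrow> real" where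
  "terminal_cost t \<xi> v V \<omega> =
     \<xi> \<omega> $ cash + (\<Sum>s=t..T. C s (S s \<omega>) (risky (V s \<omega> - prev t v V s \<omega>)))"

definition \<gamma> :: "nat \<Rightarrow> ('a \<Rightarrow> real ^ 'd) \<Rightarrow> ('a \<Rightarrow> real ^ 'd) \<Rightarrow> 'a \<Rightarrow> ereal" where
  "\<gamma> t \<xi> v = ess_inf M (F t)
     ((\<lambda>V. ess_sup M (F t) {\<lambda>\<omega>. ereal (terminal_cost t \<xi> v V \<omega>)}) ` strategies t \<xi>)"

definition \<theta> :: "nat \<Rightarrow> ('a \<Rightarrow> real ^ 'd) \<Rightarrow> ('a \<Rightarrow> real ^ 'd) \<Rightarrow> 'a \<Rightarrow> ereal" where
  "\<theta> t \<xi> V = ess_sup M (F t) {\<gamma> (t + 1) \<xi> V}"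

definition D :: "nat \<Rightarrow> ('a \<Rightarrow> real ^ 'd) \<Rightarrow> ('a \<Rightarrow> real ^ 'd) \<Rightarrow> ('a \<Rightarrow> real ^ 'd) \<Rightarrow> 'a \<Rightarrow> ereal" where
  "D t \<xi> v V \<omega> = ereal (C t (S t \<omega>) (risky (V \<omega> - v \<omega>))) + \<theta> t \<xi> V \<omega>"

definition D0_normal :: "nat \<Rightarrow> bool" where
  "D0_normal t \<longleftrightarrow>
     (\<exists>f. normal_integrand (F t) f \<and>
        (\<forall>Y\<in>borel_measurable (F t). \<forall>Z\<in>borel_measurable (F t).
           AE \<omega> in M. D t (\<lambda>_. 0) Y Z \<omega> = f \<omega> (Y \<omega>, Z \<omega>)))"

definition AIP_at :: "nat \<Rightarrow> bool" where
  "AIP_at t \<longleftrightarrow> (AE \<omega> in M. \<gamma> t (\<lambda>_. 0) (\<lambda>_. 0) \<omega> = 0)"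

definition \<N> :: "nat \<Rightarrow> ('a \<Rightarrow> real ^ 'd) set" where
  "\<N> t = {Z \<in> borel_measurable (F t).
     (AE \<omega> in M. Z \<omega> $ cash = 0) \<and> (AE \<omega> in M. D t (\<lambda>_. 0) (\<lambda>_. 0) Z \<omega> = 0)}"

definition \<N>_linear :: "nat \<Rightarrow> bool" where
  "\<N>_linear t \<longleftrightarrow>
     (\<lambda>_. 0) \<in> \<N> t \<and>
     (\<forall>Y\<in>\<N> t. \<forall>Z\<in>\<N> t. (\<lambda>\<omega>. Y \<omega> + Z \<omega>) \<in> \<N> t) \<and>
     (\<forall>a::real. \<forall>Z\<in>\<N> t. (\<lambda>\<omega>. a *\<^sub>R Z \<omega>) \<in> \<N> t)"

text \<open>\<open>D\<close> at time \<open>t\<close> involves time \<open>t + 1\<close>, so at the horizon only the first requirement is made.\<close>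

definition LAIP :: bool where
  "LAIP \<longleftrightarrow> (\<forall>t\<le>T. AIP_at t) \<and> (\<forall>t<T. \<N>_linear t)"

definition sub_additive :: "nat \<Rightarrow> bool" where
  "sub_additive t \<longleftrightarrow>
     (AE \<omega> in M. \<forall>x y. C t (S t \<omega>) (x + y) \<le> C t (S t \<omega>) x + C t (S t \<omega>) y)"

text \<open>
  A monotone bijection of \<open>[0, \<infinity>]\<close> with \<open>\<delta> \<top> = \<top>\<close> is finite at finite arguments, so \<open>enn2real\<close>
  loses nothing here.
\<close>

definition super_homogeneous :: "(ennreal \<Rightarrow> ennreal) \<Rightarrow> nat \<Rightarrow> bool" where
  "super_homogeneous \<delta> t \<longleftrightarrow>
     mono \<delta> \<and> bij \<delta> \<and> \<delta> 0 = 0 \<and> \<delta> \<top> = \<top> \<and>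
     (\<forall>l::real. l \<ge> 1 \<longrightarrow>
        (\<forall>s\<ge>0. \<forall>x. C t s (l *\<^sub>R x) \<ge> enn2real (\<delta> (ennreal l)) * C t s x))"

end

end

theory Submission
  imports Defs
begin

text \<open>
  Sub-additivity gives \<open>\<gamma>\<^sub>t(V) \<le> \<gamma>\<^sub>t(V') + C\<^sub>t(0, V'\<^sup>(\<^sup>2\<^sup>) - V\<^sup>(\<^sup>2\<^sup>))\<close> directly from the definition of \<open>\<gamma>\<^sub>t\<close>,
  because the same strategies compete for both initial positions.  Super \<open>\<delta>\<close>-homogeneity forces
  \<open>C\<^sub>t\<close> to be at most \<open>\<epsilon>\<close> near \<open>0\<close>, so \<open>\<gamma>\<^sub>t\<close> has a modulus of continuity, and the infimal
  convolution of its values at the points of a countable dense set with \<open>C\<^sub>t\<close> is the integrand.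
\<close>

section \<open>Null sets and conditional essential suprema and infima\<close>

text \<open>Since \<open>N\<close> contains all null sets of \<open>M\<close>, the exceptional set
  can be cut out without leaving \<open>N\<close>. This later allows the integrand to be redefined
  off a good set while staying measurable for \<open>N\<close>.\<close>

lemma AE_in_sub_sigma_algebra:
  assumes sub: "subalgebra M N" and null: "null_sets M \<subseteq> sets N" and P: "AE \<omega> in M. P \<omega>"
  obtains A where "A \<in> sets N" "AE \<omega> in M. \<omega> \<in> A" "\<forall>\<omega>\<in>A. P \<omega>"
proof -
  from P obtain B where B: "{\<omega> \<in> space M. \<not> P \<omega>} \<subseteq> B" "B \<in> null_sets M"
    by (auto elim!: AE_E simp: null_sets_def)
  have [measurable]: "B \<in> sets N" using B null by auto
  show thesis
  proof
    show "space N - B \<in> sets N" by simp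
    show "AE \<omega> in M. \<omega> \<in> space N - B"
      using AE_not_in[OF B(2)] AE_space sub by (auto simp: subalgebra_def)
    show "\<forall>\<omega>\<in>space N - B. P \<omega>"
      using B sub by (auto simp: subalgebra_def)
  qed
qed

text \<open>Exhaustion: some countable union has the largest measure among all countable unions.
  Adjoining one more \<open>A i\<close> cannot increase that measure, so \<open>A i\<close> is
  covered up to a null set.\<close>

lemma (in finite_measure) countable_essential_union:
  assumes \<A>: "\<And>i. i \<in> I \<Longrightarrow> A i \<in> sets M"
  obtains J where "countable J" "J \<subseteq> I" "\<And>i. i \<in> I \<Longrightarrow> AE \<omega> in M. \<omega> \<in> A i \<longrightarrow> (\<exists>j\<in>J. \<omega> \<in> A j)"
proof -
  define \<J> where "\<J> = {J. countable J \<and> J \<subseteq> I}"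
  define m where "m J = emeasure M (\<Union>j\<in>J. A j)" for J
  have meas: "(\<Union>j\<in>J. A j) \<in> sets M" if "J \<in> \<J>" for J
    using that \<A> by (intro sets.countable_UN') (auto simp: \<J>_def)
  have "\<J> \<noteq> {}" by (auto simp: \<J>_def)
  from ennreal_SUP_countable_SUP[OF this, of m]
  obtain f where f: "range f \<subseteq> m ` \<J>" "(SUP J\<in>\<J>. m J) = (SUP n::nat. f n)" by auto
  then have "\<forall>n. \<exists>J\<in>\<J>. f n = m J" by auto
  then obtain K where K: "\<And>n. K n \<in> \<J>" "\<And>n. f n = m (K n)" by metis
  \<comment> \<open>The union of a maximizing sequence of countable index sets is again countable,
    so the supremum is attained at \<open>J\<close>.\<close>
  define J where "J = (\<Union>n. K n)"
  have J: "J \<in> \<J>" using K(1) by (auto simp: J_def \<J>_def)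
  have le: "m L \<le> m J" if "L \<in> \<J>" for L
  proof -
    have "m (K n) \<le> m J" for n
      unfolding m_def by (rule emeasure_mono[OF _ meas[OF J]]) (auto simp: J_def)
    then have "(SUP L\<in>\<J>. m L) \<le> m J" unfolding f(2) K(2) by (rule SUP_least)
    then show ?thesis using SUP_upper[OF that, of m] by order
  qed
  show thesis
  proof
    show "countable J" "J \<subseteq> I" using J by (auto simp: \<J>_def)
    fix i assume i: "i \<in> I"
    have ins: "insert i J \<in> \<J>" using i J by (auto simp: \<J>_def)
    have "emeasure M (A i - (\<Union>j\<in>J. A j)) + m J = m (insert i J)"
      unfolding m_def using \<A>[OF i] meas[OF J]
      by (subst plus_emeasure) (auto intro!: arg_cong[where f="emeasure M"])
    also have "\<dots> \<le> m J" by (rule le[OF ins])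
    finally have "m J + emeasure M (A i - (\<Union>j\<in>J. A j)) \<le> m J + 0" by (simp add: add.commute)
    \<comment> \<open>Cancelling \<open>m J\<close> is legitimate because the measure is
      finite.\<close>
    then have "emeasure M (A i - (\<Union>j\<in>J. A j)) = 0"
      unfolding ennreal_add_left_cancel_le by (auto simp: m_def)
    then have "A i - (\<Union>j\<in>J. A j) \<in> null_sets M" using \<A>[OF i] meas[OF J] by (simp add: null_sets_def)
    from AE_not_in[OF this] show "AE \<omega> in M. \<omega> \<in> A i \<longrightarrow> (\<exists>j\<in>J. \<omega> \<in> A j)" by eventually_elim auto
  qed
qed

text \<open>For each level \<open>r\<close>, countably many members already cover, up to null sets,
  every event that some member falls below \<open>r\<close>. Joining these choices over the rational
  levels yields a countable subfamily whose pointwise infimum is measurable and essentially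
  minimal.\<close>

lemma (in finite_measure) ess_inf_countable:
  assumes sub: "subalgebra M N" and \<X>: "\<X> \<subseteq> borel_measurable N"
  obtains K where "countable K" "K \<subseteq> \<X>" "is_ess_inf M N \<X> (\<lambda>\<omega>. INF X\<in>K. X \<omega>)"
proof -
  have "\<exists>K. countable K \<and> K \<subseteq> \<X> \<and>
      (\<forall>X\<in>\<X>. AE \<omega> in M. X \<omega> < ereal r \<longrightarrow> (\<exists>Y\<in>K. Y \<omega> < ereal r))" for r
  proof -
    have "{\<omega>\<in>space M. X \<omega> < ereal r} \<in> sets M" if "X \<in> \<X>" for X
    proof -
      have [measurable]: "X \<in> borel_measurable M"
        using that \<X> measurable_from_subalg[OF sub] by blast
      show ?thesis by measurable
    qed
    from countable_essential_union[of \<X> "\<lambda>X. {\<omega>\<in>space M. X \<omega> < ereal r}", OF this]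
    obtain K where K: "countable K" "K \<subseteq> \<X>" "\<And>X. X \<in> \<X> \<Longrightarrow> AE \<omega> in M.
        \<omega> \<in> {\<omega>\<in>space M. X \<omega> < ereal r} \<longrightarrow> (\<exists>Y\<in>K. \<omega> \<in> {\<omega>\<in>space M. Y \<omega> < ereal r})"
      by blast
    have "AE \<omega> in M. X \<omega> < ereal r \<longrightarrow> (\<exists>Y\<in>K. Y \<omega> < ereal r)" if "X \<in> \<X>" for X
      using K(3)[OF that] AE_space by eventually_elim auto
    with K show ?thesis by blast
  qed
  from choice[OF allI, OF this] obtain k where "\<forall>r. countable (k r) \<and> k r \<subseteq> \<X> \<and>
      (\<forall>X\<in>\<X>. AE \<omega> in M. X \<omega> < ereal r \<longrightarrow> (\<exists>Y\<in>k r. Y \<omega> < ereal r))" ..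
  then have k: "\<And>r. countable (k r)" "\<And>r. k r \<subseteq> \<X>"
    "\<And>r X. X \<in> \<X> \<Longrightarrow> AE \<omega> in M. X \<omega> < ereal r \<longrightarrow> (\<exists>Y\<in>k r. Y \<omega> < ereal r)"
    by simp_all
  define K where "K = (\<Union>r\<in>\<rat>. k r)"
  have K: "countable K" "K \<subseteq> \<X>" using k(1,2) by (auto simp: K_def countable_rat)
  have "is_ess_inf M N \<X> (\<lambda>\<omega>. INF X\<in>K. X \<omega>)"
    unfolding is_ess_inf_def
  proof (intro conjI ballI impI)
    show "(\<lambda>\<omega>. INF X\<in>K. X \<omega>) \<in> borel_measurable N"
      using K \<X> by (intro borel_measurable_INF) auto
  next
    fix X assume X: "X \<in> \<X>"
    have "AE \<omega> in M. \<forall>r\<in>\<rat>. X \<omega> < ereal r \<longrightarrow> (\<exists>Y\<in>k r. Y \<omega> < ereal r)"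
      using k(3)[OF X] by (intro AE_ball_countable[THEN iffD2] countable_rat) auto
    then show "AE \<omega> in M. (INF X\<in>K. X \<omega>) \<le> X \<omega>"
    proof eventually_elim
      case (elim \<omega>)
      show ?case
      \<comment> \<open>Otherwise a rational level fits strictly between \<open>X \<omega>\<close>
        and the infimum, and some member of \<open>K\<close> already lies below that level.\<close>
      proof (rule ccontr)
        assume "\<not> ?thesis"
        then obtain r0 where r0: "X \<omega> < ereal (real_of_rat r0)" "ereal (real_of_rat r0) < (INF X\<in>K. X \<omega>)"
          using ereal_dense3 by (meson not_le)
        then obtain Y where "Y \<in> K" "Y \<omega> < ereal (real_of_rat r0)"
          using elim by (fastforce simp: K_def)
        moreover from \<open>Y \<in> K\<close> have "(INF X\<in>K. X \<omega>) \<le> Y \<omega>" by (rule INF_lower)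
        ultimately show False using r0(2) by order
      qed
    qed
  next
    fix Y' assume Y': "Y' \<in> borel_measurable N" "\<forall>X\<in>\<X>. AE \<omega> in M. Y' \<omega> \<le> X \<omega>"
    then have "AE \<omega> in M. \<forall>X\<in>K. Y' \<omega> \<le> X \<omega>"
      using K by (intro AE_ball_countable[THEN iffD2]) auto
    then show "AE \<omega> in M. Y' \<omega> \<le> (INF X\<in>K. X \<omega>)"
      by eventually_elim (auto intro: INF_greatest)
  qed
  with K show thesis by (rule that)
qed

lemma (in finite_measure) is_ess_inf_ess_inf:
  assumes "subalgebra M N" "\<X> \<subseteq> borel_measurable N"
  shows "is_ess_inf M N \<X> (ess_inf M N \<X>)"
  unfolding ess_inf_def using ess_inf_countable[OF assms] by (metis someI)

text \<open>The essential supremum is obtained as the essential infimum of all upper bounds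
  measurable for \<open>N\<close>. Its form as a countable pointwise infimum makes it an almost sure
  upper bound of \<open>X\<close> itself.\<close>

lemma (in finite_measure) is_ess_sup_ess_sup_singleton:
  assumes sub: "subalgebra M N"
  shows "is_ess_sup M N {X} (ess_sup M N {X})"
proof -
  let ?Y = "{Y \<in> borel_measurable N. AE \<omega> in M. X \<omega> \<le> Y \<omega>}"
  obtain K where K: "countable K" "K \<subseteq> ?Y" "is_ess_inf M N ?Y (\<lambda>\<omega>. INF X\<in>K. X \<omega>)"
    by (rule ess_inf_countable[OF sub, of ?Y]) auto
  have "AE \<omega> in M. \<forall>Y\<in>K. X \<omega> \<le> Y \<omega>"
    using K by (intro AE_ball_countable[THEN iffD2]) auto
  then have "AE \<omega> in M. X \<omega> \<le> (INF Y\<in>K. Y \<omega>)"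
    by eventually_elim (auto intro: INF_greatest)
  then have "is_ess_sup M N {X} (\<lambda>\<omega>. INF Y\<in>K. Y \<omega>)"
    using K(3) by (auto simp: is_ess_sup_def is_ess_inf_def)
  then show ?thesis unfolding ess_sup_def by (rule someI[where P="is_ess_sup M N {X}"])
qed

text \<open>As \<open>c\<close> is measurable for \<open>N\<close>, \<open>Y' + c\<close> is an
  admissible bound of \<open>X\<close>, and \<open>Y\<close> is the least such bound.\<close>

lemma is_ess_sup_le_add:
  assumes Y: "is_ess_sup M N {X} Y" and Y': "is_ess_sup M N {X'} Y'"
    and c: "c \<in> borel_measurable N" and le: "AE \<omega> in M. X \<omega> \<le> X' \<omega> + ereal (c \<omega>)"
  shows "AE \<omega> in M. Y \<omega> \<le> Y' \<omega> + ereal (c \<omega>)"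
proof -
  have [measurable]: "Y' \<in> borel_measurable N" using Y' by (simp add: is_ess_sup_def)
  note [measurable] = c
  have "AE \<omega> in M. X' \<omega> \<le> Y' \<omega>" using Y' by (simp add: is_ess_sup_def)
  with le have "AE \<omega> in M. X \<omega> \<le> Y' \<omega> + ereal (c \<omega>)"
    by eventually_elim (meson add_right_mono order_trans)
  moreover have "(\<lambda>\<omega>. Y' \<omega> + ereal (c \<omega>)) \<in> borel_measurable N" by measurable
  ultimately show ?thesis using Y by (simp add: is_ess_sup_def)
qed

text \<open>Here \<open>Y - c\<close> is an admissible lower bound of every \<open>f' i\<close>;
  real values of \<open>c\<close> allow it to be moved across the inequality even where
  \<open>Y\<close> is infinite.\<close>

lemma is_ess_inf_le_add:
  assumes Y: "is_ess_inf M N (f ` I) Y" and Y': "is_ess_inf M N (f' ` I) Y'"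
    and c[measurable]: "c \<in> borel_measurable N"
    and le: "\<And>i. i \<in> I \<Longrightarrow> AE \<omega> in M. f i \<omega> \<le> f' i \<omega> + ereal (c \<omega>)"
  shows "AE \<omega> in M. Y \<omega> \<le> Y' \<omega> + ereal (c \<omega>)"
proof -
  have [measurable]: "Y \<in> borel_measurable N" using Y by (simp add: is_ess_inf_def)
  have "AE \<omega> in M. Y \<omega> - ereal (c \<omega>) \<le> f' i \<omega>" if "i \<in> I" for i
  proof -
    have "AE \<omega> in M. Y \<omega> \<le> f i \<omega>" using Y that by (auto simp: is_ess_inf_def)
    with le[OF that] show ?thesis
      by eventually_elim (simp add: ereal_minus_le)
  qed
  moreover have "(\<lambda>\<omega>. Y \<omega> - ereal (c \<omega>)) \<in> borel_measurable N" by measurable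
  ultimately have "AE \<omega> in M. Y \<omega> - ereal (c \<omega>) \<le> Y' \<omega>" using Y' by (auto simp: is_ess_inf_def)
  then show ?thesis by eventually_elim (simp add: ereal_minus_le)
qed

section \<open>Normal integrands from a one-sided modulus of continuity\<close>

text \<open>For \<open>y\<close> near \<open>x\<close> the increment \<open>c (y - x)\<close> is at
  most \<open>e\<close>, so \<open>f x - e\<close> bounds \<open>f\<close> from below near
  \<open>x\<close>; an upper bound on \<open>c\<close> near \<open>0\<close> suffices.\<close>

lemma lsc_modulus:
  fixes f :: "'b::real_normed_vector \<Rightarrow> ereal" and c :: "'b \<Rightarrow> real"
  assumes le: "\<And>x y. f x \<le> f y + ereal (c (y - x))"
    and c: "\<And>e. e > 0 \<Longrightarrow> \<forall>\<^sub>F y in nhds 0. c y \<le> e"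
  shows "lsc f"
  unfolding lsc_def
proof
  fix x
  show "f x \<le> Liminf (at x) f"
  proof (rule ereal_le_epsilon2)
    fix e :: real assume e: "0 < e"
    have "((\<lambda>y. y - x) \<longlongrightarrow> 0) (at x)" by (auto intro!: tendsto_eq_intros)
    with c[OF e] have "\<forall>\<^sub>F y in at x. c (y - x) \<le> e" by (rule eventually_compose_filterlim)
    then have "\<forall>\<^sub>F y in at x. f x - ereal e \<le> f y"
    proof eventually_elim
      case (elim y)
      then have "f x \<le> f y + ereal e"
        using le[of x y] by (meson add_left_mono ereal_less_eq(3) order_trans)
      then show ?case by (simp add: ereal_minus_le)
    qed
    then have "f x - ereal e \<le> Liminf (at x) f" by (rule Liminf_bounded)
    then show "f x \<le> Liminf (at x) f + ereal e" by (simp add: ereal_minus_le)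
  qed
qed

text \<open>Each comparison in \<open>le\<close> has its own null set, depending on \<open>V\<close>
  and \<open>W\<close>. Comparing \<open>V\<close> only with constants from a countable dense set
  keeps the union of these null sets null, which turns the operator \<open>\<Gamma>\<close> on
  random positions into a function of \<open>\<omega>\<close> and \<open>x\<close>.\<close>

lemma normal_integrand_representation:
  fixes c :: "'a \<Rightarrow> 'b::{real_normed_vector, second_countable_topology} \<Rightarrow> real"
    and \<Gamma> :: "('a \<Rightarrow> 'b) \<Rightarrow> 'a \<Rightarrow> ereal"
  assumes sub: "subalgebra M N" and null: "null_sets M \<subseteq> sets N"
    and c: "(\<lambda>(\<omega>, x). c \<omega> x) \<in> borel_measurable (N \<Otimes>\<^sub>M borel)"
    and subadd: "AE \<omega> in M. \<forall>x y. c \<omega> (x + y) \<le> c \<omega> x + c \<omega> y"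
    and small: "AE \<omega> in M. \<forall>e>0. \<forall>\<^sub>F y in nhds 0. c \<omega> y \<le> e"
    and \<Gamma>: "\<And>V. V \<in> borel_measurable N \<Longrightarrow> \<Gamma> V \<in> borel_measurable N"
    and le: "\<And>V W. V \<in> borel_measurable N \<Longrightarrow> W \<in> borel_measurable N \<Longrightarrow>
      AE \<omega> in M. \<Gamma> V \<omega> \<le> \<Gamma> W \<omega> + ereal (c \<omega> (W \<omega> - V \<omega>))"
  shows "\<exists>g. normal_integrand N g \<and> (\<forall>V\<in>borel_measurable N. AE \<omega> in M. \<Gamma> V \<omega> = g \<omega> (V \<omega>))"
proof -
  obtain Q :: "'b set" where Q: "countable Q" "\<And>X. open X \<Longrightarrow> X \<noteq> {} \<Longrightarrow> \<exists>q\<in>Q. q \<in> X"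
    by (rule countable_dense_setE) blast
  have "AE \<omega> in M. (\<forall>x y. c \<omega> (x + y) \<le> c \<omega> x + c \<omega> y) \<and> (\<forall>e>0. \<forall>\<^sub>F y in nhds 0. c \<omega> y \<le> e)"
    using subadd small by eventually_elim auto
  then obtain A where A: "A \<in> sets N" "AE \<omega> in M. \<omega> \<in> A"
    and A_good: "\<forall>\<omega>\<in>A.
      (\<forall>x y. c \<omega> (x + y) \<le> c \<omega> x + c \<omega> y) \<and> (\<forall>e>0. \<forall>\<^sub>F y in nhds 0. c \<omega> y \<le> e)"
    by (rule AE_in_sub_sigma_algebra[OF sub null]) (rule that)
  have A_subadd: "c \<omega> (x + y) \<le> c \<omega> x + c \<omega> y" if "\<omega> \<in> A" for \<omega> x y
    using A_good that by simp
  have A_small: "\<forall>\<^sub>F y in nhds 0. c \<omega> y \<le> e" if "\<omega> \<in> A" "e > 0" for \<omega> e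
    using A_good that by simp
  note [measurable] = A(1) c
  \<comment> \<open>The value \<open>0\<close> off \<open>A\<close> secures lower semicontinuity at
    every \<open>\<omega>\<close>, not just almost every one, as \<open>normal_integrand\<close>
    demands.\<close>
  define g where "g \<omega> x = (if \<omega> \<in> A then INF q\<in>Q. \<Gamma> (\<lambda>_. q) \<omega> + ereal (c \<omega> (q - x)) else 0)" for \<omega> x
  have g_le: "g \<omega> x \<le> g \<omega> y + ereal (c \<omega> (y - x))" if \<omega>: "\<omega> \<in> A" for \<omega> x y
  proof -
    \<comment> \<open>The cost is moved to the left so that the bound can pass to the infimum over
      \<open>q\<close> defining \<open>g \<omega> y\<close>.\<close>
    have "g \<omega> x - ereal (c \<omega> (y - x)) \<le> \<Gamma> (\<lambda>_. q) \<omega> + ereal (c \<omega> (q - y))" if "q \<in> Q" for q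
    proof -
      have "c \<omega> (q - x) \<le> c \<omega> (q - y) + c \<omega> (y - x)"
        using A_subadd[OF \<omega>, of "q - y" "y - x"] by simp
      then have "\<Gamma> (\<lambda>_. q) \<omega> + ereal (c \<omega> (q - x))
          \<le> \<Gamma> (\<lambda>_. q) \<omega> + ereal (c \<omega> (q - y) + c \<omega> (y - x))"
        by (intro add_left_mono) simp
      moreover have "g \<omega> x \<le> \<Gamma> (\<lambda>_. q) \<omega> + ereal (c \<omega> (q - x))"
        using \<omega> that by (auto simp: g_def intro: INF_lower)
      ultimately show ?thesis
        by (simp add: ereal_minus_le add.assoc)
    qed
    then have "g \<omega> x - ereal (c \<omega> (y - x)) \<le> g \<omega> y"
      using \<omega> by (subst (2) g_def) (auto intro: INF_greatest)
    then show ?thesis by (simp add: ereal_minus_le)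
  qed
  have "lsc (g \<omega>)" for \<omega>
  proof (cases "\<omega> \<in> A")
    case True
    show ?thesis by (rule lsc_modulus[where c="c \<omega>"]) (use True g_le A_small in auto)
  next
    case False
    then show ?thesis
      by (intro lsc_modulus[where c="\<lambda>_. 0"]) (auto simp: g_def)
  qed
  moreover have "(\<lambda>(\<omega>, x). g \<omega> x) \<in> borel_measurable (N \<Otimes>\<^sub>M borel)"
  proof -
    have [measurable]: "(\<lambda>p. \<Gamma> (\<lambda>_. q) (fst p) + ereal (c (fst p) (q - snd p))) \<in> borel_measurable (N \<Otimes>\<^sub>M borel)" for q
    proof -
      have [measurable]: "\<Gamma> (\<lambda>_. q) \<in> borel_measurable N" by (rule \<Gamma>) simp
      have "(\<lambda>p. (fst p, q - snd p)) \<in> N \<Otimes>\<^sub>M borel \<rightarrow>\<^sub>M N \<Otimes>\<^sub>M borel" by measurable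
      from measurable_compose[OF this c]
      have [measurable]: "(\<lambda>p. c (fst p) (q - snd p)) \<in> borel_measurable (N \<Otimes>\<^sub>M borel)" by simp
      show ?thesis by measurable
    qed
    have "(\<lambda>p. INF q\<in>Q. \<Gamma> (\<lambda>_. q) (fst p) + ereal (c (fst p) (q - snd p))) \<in> borel_measurable (N \<Otimes>\<^sub>M borel)"
      by (rule borel_measurable_INF[OF Q(1)]) measurable
    then show ?thesis unfolding g_def split_beta' by measurable
  qed
  ultimately have "normal_integrand N g" by (simp add: normal_integrand_def)
  moreover have "AE \<omega> in M. \<Gamma> V \<omega> = g \<omega> (V \<omega>)" if V: "V \<in> borel_measurable N" for V
  proof -
    \<comment> \<open>The first inequality gives \<open>\<Gamma> V \<le> g\<close>; the second, with
      \<open>q\<close> close to \<open>V \<omega>\<close>, gives the converse up to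
      \<open>e\<close>.\<close>
    have "AE \<omega> in M. \<forall>q\<in>Q. \<Gamma> V \<omega> \<le> \<Gamma> (\<lambda>_. q) \<omega> + ereal (c \<omega> (q - V \<omega>)) \<and>
        \<Gamma> (\<lambda>_. q) \<omega> \<le> \<Gamma> V \<omega> + ereal (c \<omega> (V \<omega> - q))"
      using le V by (intro AE_ball_countable[THEN iffD2] Q(1) ballI AE_conjI) auto
    with A(2) show ?thesis
    proof eventually_elim
      case (elim \<omega>)
      have "g \<omega> (V \<omega>) \<le> \<Gamma> V \<omega> + ereal e" if e: "e > 0" for e
      proof -
        have e2: "e / 2 > 0" using e by simp
        \<comment> \<open>Both directions must be cheap: \<open>\<Gamma>\<close> is compared from
          \<open>q\<close> to \<open>V\<close>, and \<open>g\<close> then charges the way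
          back.\<close>
        have "\<forall>\<^sub>F y in nhds (V \<omega>). c \<omega> (V \<omega> - y) \<le> e/2"
          by (rule eventually_compose_filterlim[OF A_small[OF elim(1) e2]])
            (auto intro!: tendsto_eq_intros filterlim_ident)
        moreover have "\<forall>\<^sub>F y in nhds (V \<omega>). c \<omega> (y - V \<omega>) \<le> e/2"
          by (rule eventually_compose_filterlim[OF A_small[OF elim(1) e2]])
            (auto intro!: tendsto_eq_intros filterlim_ident)
        ultimately have "\<forall>\<^sub>F y in nhds (V \<omega>). c \<omega> (V \<omega> - y) + c \<omega> (y - V \<omega>) \<le> e"
          by eventually_elim simp
        then obtain X where "open X" "V \<omega> \<in> X" "\<forall>y\<in>X. c \<omega> (V \<omega> - y) + c \<omega> (y - V \<omega>) \<le> e"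
          by (auto simp: eventually_nhds)
        then obtain q where q: "q \<in> Q" "c \<omega> (V \<omega> - q) + c \<omega> (q - V \<omega>) \<le> e" using Q(2) by blast
        have "g \<omega> (V \<omega>) \<le> \<Gamma> (\<lambda>_. q) \<omega> + ereal (c \<omega> (q - V \<omega>))"
          using elim(1) q(1) by (auto simp: g_def intro: INF_lower)
        also have "\<dots> \<le> \<Gamma> V \<omega> + ereal (c \<omega> (V \<omega> - q)) + ereal (c \<omega> (q - V \<omega>))"
          using elim(2) q(1) by (intro add_right_mono) auto
        also have "\<dots> \<le> \<Gamma> V \<omega> + ereal e"
          unfolding add.assoc using q(2) by (intro add_left_mono) simp
        finally show ?thesis .
      qed
      then have "g \<omega> (V \<omega>) \<le> \<Gamma> V \<omega>" by (rule ereal_le_epsilon2)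
      moreover have "\<Gamma> V \<omega> \<le> g \<omega> (V \<omega>)" using elim by (auto simp: g_def intro: INF_greatest)
      ultimately show ?case by (rule antisym[rotated])
    qed
  qed
  ultimately show ?thesis by blast
qed

section \<open>Trading costs and hedging costs\<close>

context market
begin

lemma risky_linear: "linear risky"
  by (rule linearI) (auto simp: risky_def vec_eq_iff)

text \<open>Scaling \<open>x\<close> to norm one by \<open>l = 1 / norm x\<close> gives
  \<open>\<delta> l * C x \<le> C (l x) \<le> K\<close>, where \<open>K\<close> bounds the cost on
  the unit ball. Hence \<open>C x \<le> e\<close> once \<open>\<delta> l\<close> reaches
  \<open>K / e\<close>, that is, for small \<open>x\<close>.\<close>

lemma cost_small_near_zero:
  assumes hom: "super_homogeneous \<delta> t" and t: "t \<le> T" and s: "0 \<le> s" and e: "e > 0"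
  shows "\<forall>\<^sub>F x in nhds 0. C t s x \<le> e"
proof -
  obtain b where b: "continuous_on UNIV (\<lambda>(s, x). b s x)" "\<And>s x. 0 \<le> s \<Longrightarrow> \<bar>C t s x\<bar> \<le> b s x"
    using C_bound[OF t] by blast
  have "continuous_on UNIV (\<lambda>x. b s x)"
    using continuous_on_compose2[OF b(1), of UNIV "\<lambda>x. (s, x)"] by (simp add: continuous_on_Pair)
  then have "compact (b s ` cball 0 1)"
    by (intro compact_continuous_image) (auto intro: continuous_on_subset)
  then have "bounded (b s ` cball 0 1)" by (rule compact_imp_bounded)
  then obtain K where K: "K > 0" "\<forall>y\<in>b s ` cball 0 1. norm y \<le> K" by (auto simp: bounded_pos)
  have bK: "b s x \<le> K" if "norm x \<le> 1" for x
    using K(2) that by force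
  from hom have \<delta>: "mono \<delta>" "bij \<delta>" "\<delta> \<top> = \<top>"
    and C_ge: "\<And>l x. l \<ge> 1 \<Longrightarrow> C t s (l *\<^sub>R x) \<ge> enn2real (\<delta> (ennreal l)) * C t s x"
    using s by (auto simp: super_homogeneous_def)
  \<comment> \<open>Surjectivity of \<open>\<delta>\<close> provides the scale at which it reaches
    \<open>K / e\<close>; this scale is finite because \<open>\<delta>\<close> sends
    \<open>\<top>\<close> to \<open>\<top>\<close>.\<close>
  obtain a where a: "\<delta> a = ennreal (K / e)" using \<delta>(2) by (metis bij_pointE)
  then have "a \<noteq> \<top>" using \<delta>(3) by auto
  then obtain r where r: "a = ennreal r" "r \<ge> 0" by (metis enn2real_nonneg ennreal_enn2real_if)
  \<comment> \<open>The radius ensures both \<open>l \<ge> 1\<close>, the range where super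
    homogeneity applies, and \<open>l \<ge> r\<close>, hence
    \<open>\<delta> l \<ge> K / e\<close>.\<close>
  have "C t s x \<le> e" if x: "norm x < inverse (max 1 r)" for x
  proof (cases "x = 0")
    case True
    then show ?thesis using C_zero[OF t s] e by simp
  next
    case False
    define l where "l = inverse (norm x)"
    have "max 1 r \<le> l" unfolding l_def using x False by (smt (verit) le_imp_inverse_le inverse_inverse_eq zero_less_norm_iff)
    then have l: "l \<ge> 1" "l \<ge> r" by auto
    \<comment> \<open>Finiteness matters because \<open>enn2real\<close> sends \<open>\<top>\<close>
      to \<open>0\<close>, which would destroy the lower bound.\<close>
    have top: "\<delta> (ennreal l) \<noteq> \<top>"
      using \<delta>(2,3) by (metis bij_def injD ennreal_neq_top)
    have "ennreal (K / e) \<le> \<delta> (ennreal l)"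
      using \<delta>(1) l(2) a r by (metis ennreal_leI monoD)
    then have "enn2real (ennreal (K / e)) \<le> enn2real (\<delta> (ennreal l))"
      using top by (intro enn2real_mono) (auto simp: less_top)
    then have ge: "K / e \<le> enn2real (\<delta> (ennreal l))" using K(1) e by simp
    have "enn2real (\<delta> (ennreal l)) * C t s x \<le> C t s (l *\<^sub>R x)" by (rule C_ge[OF l(1)])
    also have "\<dots> \<le> K"
      using b(2)[OF s, of "l *\<^sub>R x"] bK[of "l *\<^sub>R x"] False by (auto simp: l_def)
    finally have *: "enn2real (\<delta> (ennreal l)) * C t s x \<le> K" .
    show ?thesis
    proof (rule ccontr)
      assume "\<not> C t s x \<le> e"
      \<comment> \<open>A cost above \<open>e\<close> is positive, so replacing \<open>K / e\<close>
        by the larger \<open>\<delta> l\<close> preserves the inequality and gives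
        \<open>K < K\<close>.\<close>
      then have "K / e * e < K / e * C t s x" using K(1) e by (intro mult_strict_left_mono) auto
      also have "\<dots> \<le> enn2real (\<delta> (ennreal l)) * C t s x"
        using ge \<open>\<not> C t s x \<le> e\<close> e by (intro mult_right_mono) auto
      finally show False using * e by simp
    qed
  qed
  moreover have "inverse (max 1 r) > 0" by simp
  ultimately show ?thesis
    unfolding eventually_nhds_metric by (metis dist_norm diff_zero)
qed

text \<open>The initial position enters only the summand at time \<open>t\<close>; there the trade
  from \<open>v\<close> is split into a trade to \<open>w\<close> and one from \<open>w\<close>, and
  sub-additivity applies.\<close>

lemma terminal_cost_le:
  assumes sa: "\<forall>x y. C t (S t \<omega>) (x + y) \<le> C t (S t \<omega>) x + C t (S t \<omega>) y" and t: "t \<le> T"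
  shows "terminal_cost t \<xi> v V \<omega> \<le> terminal_cost t \<xi> w V \<omega> + C t (S t \<omega>) (risky (w \<omega> - v \<omega>))"
proof -
  have split: "terminal_cost t \<xi> u V \<omega> = \<xi> \<omega> $ cash + C t (S t \<omega>) (risky (V t \<omega> - u \<omega>))
      + (\<Sum>s=Suc t..T. C s (S s \<omega>) (risky (V s \<omega> - V (s - 1) \<omega>)))" for u
    using t by (simp add: terminal_cost_def prev_def sum.atLeast_Suc_atMost)
  have "risky (V t \<omega> - v \<omega>) = risky (V t \<omega> - w \<omega>) + risky (w \<omega> - v \<omega>)"
    using linear_add[OF risky_linear, of "V t \<omega> - w \<omega>" "w \<omega> - v \<omega>"] by simp
  then show ?thesis unfolding split using sa by simp
qed

lemma is_ess_inf_\<gamma>: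
  assumes "t \<le> T"
  shows "is_ess_inf M (F t)
    ((\<lambda>V. ess_sup M (F t) {\<lambda>\<omega>. ereal (terminal_cost t \<xi> v V \<omega>)}) ` strategies t \<xi>) (\<gamma> t \<xi> v)"
  unfolding \<gamma>_def
  using is_ess_sup_ess_sup_singleton[OF subalgebra_F[OF assms]]
  by (intro is_ess_inf_ess_inf subalgebra_F assms) (auto simp: is_ess_sup_def)

text \<open>The set \<open>strategies t \<xi>\<close> does not depend on the initial position, so
  the pathwise comparison of the same \<open>V\<close> passes through the essential supremum and
  then the essential infimum.\<close>

lemma \<gamma>_le:
  assumes t: "t \<le> T" and sa: "sub_additive t"
    and c: "(\<lambda>\<omega>. C t (S t \<omega>) (risky (w \<omega> - v \<omega>))) \<in> borel_measurable (F t)"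
  shows "AE \<omega> in M. \<gamma> t \<xi> v \<omega> \<le> \<gamma> t \<xi> w \<omega> + ereal (C t (S t \<omega>) (risky (w \<omega> - v \<omega>)))"
proof (rule is_ess_inf_le_add[OF is_ess_inf_\<gamma>[OF t] is_ess_inf_\<gamma>[OF t] c])
  fix V
  show "AE \<omega> in M. ess_sup M (F t) {\<lambda>\<omega>. ereal (terminal_cost t \<xi> v V \<omega>)} \<omega>
      \<le> ess_sup M (F t) {\<lambda>\<omega>. ereal (terminal_cost t \<xi> w V \<omega>)} \<omega>
        + ereal (C t (S t \<omega>) (risky (w \<omega> - v \<omega>)))"
  proof (rule is_ess_sup_le_add[OF _ _ c])
    show "AE \<omega> in M. ereal (terminal_cost t \<xi> v V \<omega>)
        \<le> ereal (terminal_cost t \<xi> w V \<omega>) + ereal (C t (S t \<omega>) (risky (w \<omega> - v \<omega>)))"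
      using sa[unfolded sub_additive_def] by eventually_elim (simp add: terminal_cost_le t)
  qed (intro is_ess_sup_ess_sup_singleton subalgebra_F t)+
qed

lemma \<gamma>_normal_integrand:
  assumes t: "t \<le> T" and C_normal: "normal_integrand (F t) (\<lambda>\<omega> z. ereal (C t (S t \<omega>) z))"
    and sa: "sub_additive t" and hom: "super_homogeneous \<delta> t"
  shows "\<exists>g. normal_integrand (F t) g \<and> (\<forall>V\<in>borel_measurable (F t). AE \<omega> in M. \<gamma> t \<xi> V \<omega> = g \<omega> (V \<omega>))"
proof -
  have null: "null_sets M \<subseteq> sets (F t)" using null_F mono_F[of 0 t] t by auto
  have risky_cont: "continuous_on UNIV risky"
    by (rule linear_continuous_on) (simp add: risky_linear linear_conv_bounded_linear[symmetric])
  have "(\<lambda>(\<omega>, z). ereal (C t (S t \<omega>) z)) \<in> borel_measurable (F t \<Otimes>\<^sub>M borel)"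
    using C_normal by (simp add: normal_integrand_def)
  \<comment> \<open>The representation needs a real-valued cost, whereas normality is stated for its
    extended real version.\<close>
  then have "(\<lambda>p. real_of_ereal (case p of (\<omega>, z) \<Rightarrow> ereal (C t (S t \<omega>) z))) \<in> borel_measurable (F t \<Otimes>\<^sub>M borel)"
    by (rule borel_measurable_real_of_ereal)
  then have C_meas: "(\<lambda>p. C t (S t (fst p)) (snd p)) \<in> borel_measurable (F t \<Otimes>\<^sub>M borel)"
    by (simp add: split_beta')
  have [measurable]: "risky \<in> borel_measurable borel"
    by (rule borel_measurable_continuous_onI[OF risky_cont])
  have "(\<lambda>p. (fst p, risky (snd p))) \<in> F t \<Otimes>\<^sub>M borel \<rightarrow>\<^sub>M F t \<Otimes>\<^sub>M borel" by measurable
  from measurable_compose[OF this C_meas]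
  have c_meas: "(\<lambda>(\<omega>, x). C t (S t \<omega>) (risky x)) \<in> borel_measurable (F t \<Otimes>\<^sub>M borel)"
    by (simp add: split_beta')
  show ?thesis
  proof (rule normal_integrand_representation[OF subalgebra_F[OF t] null c_meas])
    show "AE \<omega> in M. \<forall>x y. C t (S t \<omega>) (risky (x + y)) \<le> C t (S t \<omega>) (risky x) + C t (S t \<omega>) (risky y)"
      using sa[unfolded sub_additive_def] by eventually_elim (simp add: linear_add[OF risky_linear])
    \<comment> \<open>Continuity of \<open>risky\<close> at \<open>0\<close> carries the smallness
      of the cost over to its risky part.\<close>
    have "(risky \<longlongrightarrow> 0) (nhds 0)"
      using risky_cont linear_0[OF risky_linear]
      by (metis continuous_on_eq_continuous_within isCont_def tendsto_nhds_iff UNIV_I)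
    then have "\<forall>\<^sub>F y in nhds 0. C t (S t \<omega>) (risky y) \<le> e" if "\<omega> \<in> space M" "e > 0" for \<omega> e
      using cost_small_near_zero[OF hom t S_nonneg[OF t that(1)] that(2)]
      by (rule eventually_compose_filterlim[rotated])
    then show "AE \<omega> in M. \<forall>e>0. \<forall>\<^sub>F y in nhds 0. C t (S t \<omega>) (risky y) \<le> e" by auto
  next
    fix V :: "'a \<Rightarrow> real ^ 'd"
    show "\<gamma> t \<xi> V \<in> borel_measurable (F t)" using is_ess_inf_\<gamma>[OF t] by (auto simp: is_ess_inf_def)
  next
    fix V W :: "'a \<Rightarrow> real ^ 'd"
    assume [measurable]: "V \<in> borel_measurable (F t)" "W \<in> borel_measurable (F t)"
    have "(\<lambda>\<omega>. (\<omega>, W \<omega> - V \<omega>)) \<in> F t \<rightarrow>\<^sub>M F t \<Otimes>\<^sub>M borel" by measurable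
    from measurable_compose[OF this c_meas]
    show "AE \<omega> in M. \<gamma> t \<xi> V \<omega> \<le> \<gamma> t \<xi> W \<omega> + ereal (C t (S t \<omega>) (risky (W \<omega> - V \<omega>)))"
      by (intro \<gamma>_le t sa) simp
  qed
qed

end

theorem theorem4p25:
  fixes M :: "'a measure" and F :: "nat \<Rightarrow> 'a measure" and T t :: nat
    and S :: "nat \<Rightarrow> 'a \<Rightarrow> real ^ 'm"
    and C :: "nat \<Rightarrow> real ^ 'm \<Rightarrow> real ^ 'd \<Rightarrow> real"
    and cash :: 'd
    and \<xi> :: "'a \<Rightarrow> real ^ 'd"
    and \<gamma>' :: "'a \<Rightarrow> real ^ 'd \<Rightarrow> ereal"
    and h :: "nat \<Rightarrow> 'a \<Rightarrow> real ^ 'd \<Rightarrow> real"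
    and \<delta> :: "ennreal \<Rightarrow> ennreal"
  assumes "market M F T S C cash"
    and "\<And>u. u < T \<Longrightarrow> market.D0_normal M F T S C cash u"
    and "t < T"
    and "\<xi> \<in> borel_measurable (F T)"
    and "market.hedgeable M F T S C cash \<xi>"
    and "normal_integrand (F (t + 1)) \<gamma>'"
    and "\<And>V. V \<in> borel_measurable (F t) \<Longrightarrow>
           AE \<omega> in M. market.\<gamma> M F T S C cash (t + 1) \<xi> V \<omega> = \<gamma>' \<omega> (V \<omega>)"
    and "\<And>u. u \<le> T \<Longrightarrow> (\<lambda>(\<omega>, x). h u \<omega> x) \<in> borel_measurable (F u \<Otimes>\<^sub>M borel)"
    and "\<And>u. u \<le> T \<Longrightarrow> AE \<omega> in M. continuous_on UNIV (h u \<omega>)"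
    and "\<And>u. u \<le> T \<Longrightarrow> AE \<omega> in M. \<forall>x. \<bar>C u (S u \<omega>) (market.risky cash x)\<bar> < h u \<omega> x"
    and "normal_integrand (F t) (\<lambda>\<omega> z. ereal (C t (S t \<omega>) z))"
    and "market.sub_additive M S C t"
    and "market.super_homogeneous C \<delta> t"
    and "market.LAIP M F T S C cash"
  shows "\<exists>g. normal_integrand (F t) g \<and>
           (\<forall>V\<in>borel_measurable (F t). AE \<omega> in M. market.\<gamma> M F T S C cash t \<xi> V \<omega> = g \<omega> (V \<omega>))"
  using market.\<gamma>_normal_integrand[OF assms(1)] assms(3,11-13) by simp

end
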